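(* For all integers $n\ge1$ and $r\ge 0$, \[\mathcal{C}^n_r=\mathcal{C}^{[n]}_r\qquad\text{and}\qquad Q^n_r=Q^{[n]}_r,\] where kernels on the finite set $[n]=\{1,\dots,n\}$ are identified with symmetric $n\times n$ real matrices.
   Context: Let $\mathbb{S}^n$ be the space of symmetric $n\times n$ real matrices and $e$ the all-ones vector. For $\beta\in\mathbb{N}^n$ (with $0\in\mathbb{N}$) write $|\beta|=\beta_1+\dots+\beta_n$ and $x^\beta=x_1^{\beta_1}\cdots x_n^{\beta_n}$. Define $\mathcal{C}^n_r=\{M\in\mathbb{S}^n:\ (e^\top x)^r(x^\top Mx)\text{ has nonnegative coefficients}\}$ (as a polynomial in $x=(x_1,\dots,x_n)$), and $Q^n_r=\{M\in\mathbb{S}^n:\ (e^\top x)^r(x^\top Mx)=\sum_{|\beta|=r}x^\beta\,x^\top N_\beta x+\sum_{|\beta|=r}x^\beta\,x^\top S_\beta x$ for some $N_\beta,S_\beta\in\mathbb{S}^n$ with $N_\beta\ge0$ (entrywise) and $S_\beta\succeq0$ (positive semidefinite) for all $\beta\in\mathbb{N}^n$, $|\beta|=r\}$. For a set $V$ (here $V=[n]$, with the discrete topology), $\mathcal{K}(V)$ is the set of kernels on $V$: continuous symmetric functions $V\times V\to\mathbb{R}$. $\mathrm{PSD}(V)$ is the set of kernels whose restriction to $U\times U$ is a positive semidefinite matrix for every finite $U\subset V$. A tensor of order $r$ over $V$ is a function $V^r\to\mathbb{R}$; $\mathcal{T}^V_r$ is the set of these, and $\mathcal{N}^V_r$ is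 the set of those that are nonnegative everywhere. A kernel is regarded as a tensor of order $2$. For $r\ge 0$, the stack operator $\mathbf{Stk}^r:\mathcal{T}^V_d\to\mathcal{T}^V_{d+r}$ is $\mathbf{Stk}^r(T)(u,v)=T(u)$ for $u\in V^d$, $v\in V^r$. The symmetrization $\sigma:\mathcal{T}^V_d\to\mathcal{T}^V_d$ is $\sigma(T)(v)=\frac{1}{d!}\sum_{\pi\in Sym(d)}T(\pi v)$, where $Sym(d)$ is the group of permutations of $d$ elements and $\pi v=(v_{\pi(1)},\dots,v_{\pi(d)})$. A tensor $F\in\mathcal{T}^V_{r+2}$ is 2-PSD on $V$ if it is continuous and for all $z\in V^r$, $F(\cdot,\cdot,z)\in\mathrm{PSD}(V)$. For an integer $r\ge 0$: $\mathcal{C}^V_r=\{M\in\mathcal{K}(V):\ \sigma(\mathbf{Stk}^r(M))=\sigma(N)\text{ for some }N\in\mathcal{N}^V_{r+2}\}$, and $Q^V_r=\{M\in\mathcal{K}(V):\ \sigma(\mathbf{Stk}^r(M))=\sigma(N)+\sigma(S)\text{ for some }N\in\mathcal{N}^V_{r+2}\text{ and some 2-PSD }S\in\mathcal{T}^V_{r+2}\}$. *)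

theory Defs
  imports
    "HOL-Analysis.Analysis"
    "HOL-Library.Poly_Mapping"
    "Jordan_Normal_Form.Matrix"
begin

section \<open>The matrix cones\<close>

text \<open>
  Indices are \<open>0\<close>-based as usual for \<^typ>\<open>real mat\<close>, so \<open>{..<n}\<close> plays the role of \<open>[n]\<close>.
  Polynomials in \<open>x\<^sub>0, x\<^sub>1, \<dots>\<close> are elements of \<^typ>\<open>(nat \<Rightarrow>\<^sub>0 nat) \<Rightarrow>\<^sub>0 real\<close>, i.e. maps from
  exponents to coefficients; \<open>*\<close> on this type is the convolution product.
\<close>

type_synonym rpoly = "(nat \<Rightarrow>\<^sub>0 nat) \<Rightarrow>\<^sub>0 real"

definition x_pow :: "(nat \<Rightarrow>\<^sub>0 nat) \<Rightarrow> rpoly" where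
  "x_pow \<beta> = Poly_Mapping.single \<beta> 1"

definition x_var :: "nat \<Rightarrow> rpoly" where
  "x_var i = x_pow (Poly_Mapping.single i 1)"

definition const_poly :: "real \<Rightarrow> rpoly" where
  "const_poly c = Poly_Mapping.single 0 c"

definition e_form :: "nat \<Rightarrow> rpoly" where
  "e_form n = (\<Sum>i<n. x_var i)"

definition quad_form :: "nat \<Rightarrow> real mat \<Rightarrow> rpoly" where
  "quad_form n M = (\<Sum>i<n. \<Sum>j<n. const_poly (M $$ (i, j)) * x_var i * x_var j)"

definition multi_indices :: "nat \<Rightarrow> nat \<Rightarrow> (nat \<Rightarrow>\<^sub>0 nat) set" where
  "multi_indices n r =
    {\<beta>. Poly_Mapping.keys \<beta> \<subseteq> {..<n} \<and> (\<Sum>i<n. Poly_Mapping.lookup \<beta> i) = r}"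

definition sym_mats :: "nat \<Rightarrow> real mat set" where
  "sym_mats n = {M \<in> carrier_mat n n. transpose_mat M = M}"

definition nonneg_mat :: "nat \<Rightarrow> real mat \<Rightarrow> bool" where
  "nonneg_mat n M \<longleftrightarrow> (\<forall>i<n. \<forall>j<n. 0 \<le> M $$ (i, j))"

definition psd_mat :: "nat \<Rightarrow> real mat \<Rightarrow> bool" where
  "psd_mat n M \<longleftrightarrow> (\<forall>v \<in> carrier_vec n. 0 \<le> scalar_prod v (M *\<^sub>v v))"

definition C_mat :: "nat \<Rightarrow> nat \<Rightarrow> real mat set" where
  "C_mat n r =
    {M \<in> sym_mats n. \<forall>\<alpha>. 0 \<le> Poly_Mapping.lookup (e_form n ^ r * quad_form n M) \<alpha>}"

definition Q_mat :: "nat \<Rightarrow> nat \<Rightarrow> real mat set" where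
  "Q_mat n r =
    {M \<in> sym_mats n. \<exists>N S.
      (\<forall>\<beta> \<in> multi_indices n r.
        N \<beta> \<in> sym_mats n \<and> S \<beta> \<in> sym_mats n \<and> nonneg_mat n (N \<beta>) \<and> psd_mat n (S \<beta>)) \<and>
      e_form n ^ r * quad_form n M =
        (\<Sum>\<beta> \<in> multi_indices n r. x_pow \<beta> * quad_form n (N \<beta>)) +
        (\<Sum>\<beta> \<in> multi_indices n r. x_pow \<beta> * quad_form n (S \<beta>))}"

text \<open>The sums over multi-indices above range over a finite set, so they are not trivially zero.\<close>

lemma finite_multi_indices: "finite (multi_indices n r)"
proof (rule finite_imageD)
  let ?F = "{f. \<forall>i. (i \<in> {..<n} \<longrightarrow> f i \<in> {..r}) \<and> (i \<notin> {..<n} \<longrightarrow> f i = (0 :: nat))}"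
  have "Poly_Mapping.lookup ` multi_indices n r \<subseteq> ?F"
  proof (rule image_subsetI)
    fix \<beta> assume "\<beta> \<in> multi_indices n r"
    then have keys: "Poly_Mapping.keys \<beta> \<subseteq> {..<n}"
      and r: "(\<Sum>i<n. Poly_Mapping.lookup \<beta> i) = r"
      unfolding multi_indices_def by blast+
    have "Poly_Mapping.lookup \<beta> i \<le> r" if "i \<in> {..<n}" for i
      unfolding r[symmetric] by (rule member_le_sum[OF that]) simp_all
    moreover have "Poly_Mapping.lookup \<beta> i = 0" if "i \<notin> {..<n}" for i
      using subsetD[OF keys, of i] that unfolding in_keys_iff by blast
    ultimately show "Poly_Mapping.lookup \<beta> \<in> ?F"
      by blast
  qed
  moreover have "finite ?F"
    by (rule finite_set_of_finite_funs) simp_all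
  ultimately show "finite (Poly_Mapping.lookup ` multi_indices n r)"
    by (rule finite_subset)
  show "inj_on Poly_Mapping.lookup (multi_indices n r)"
    by (rule inj_onI) (rule poly_mapping_eqI, rule fun_cong)
qed


section \<open>The kernel cones\<close>

text \<open>
  The topological space \<open>V\<close> is given by a topology \<open>X\<close> with \<^term>\<open>topspace X\<close> as its set of points.
  Elements of \<open>V\<^sup>d\<close> are functions on \<open>{..<d}\<close>. Tensors and kernels are extensional functions
  (they are \<^const>\<open>undefined\<close> outside \<open>V\<^sup>d\<close> and \<open>V \<times> V\<close>), so that \<open>=\<close> means equality on \<open>V\<^sup>d\<close>
  and \<open>V \<times> V\<close>, respectively.
\<close>

definition tuples :: "'a topology \<Rightarrow> nat \<Rightarrow> (nat \<Rightarrow> 'a) set" where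
  "tuples X d = ({..<d} \<rightarrow>\<^sub>E topspace X)"

type_synonym 'a tensor = "(nat \<Rightarrow> 'a) \<Rightarrow> real"

definition tensors :: "'a topology \<Rightarrow> nat \<Rightarrow> 'a tensor set" where
  "tensors X d = (tuples X d \<rightarrow>\<^sub>E UNIV)"

definition nonneg_tensors :: "'a topology \<Rightarrow> nat \<Rightarrow> 'a tensor set" where
  "nonneg_tensors X d = {T \<in> tensors X d. \<forall>v \<in> tuples X d. 0 \<le> T v}"

definition tensor_add :: "'a topology \<Rightarrow> nat \<Rightarrow> 'a tensor \<Rightarrow> 'a tensor \<Rightarrow> 'a tensor" where
  "tensor_add X d S T = (\<lambda>v \<in> tuples X d. S v + T v)"

definition kernels :: "'a topology \<Rightarrow> ('a \<times> 'a \<Rightarrow> real) set" where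
  "kernels X =
    {K \<in> topspace X \<times> topspace X \<rightarrow>\<^sub>E UNIV.
      continuous_map (prod_topology X X) euclideanreal K \<and>
      (\<forall>x \<in> topspace X. \<forall>y \<in> topspace X. K (x, y) = K (y, x))}"

definition psd_kernels :: "'a topology \<Rightarrow> ('a \<times> 'a \<Rightarrow> real) set" where
  "psd_kernels X =
    {K \<in> kernels X. \<forall>U. finite U \<and> U \<subseteq> topspace X \<longrightarrow>
      (\<forall>c :: 'a \<Rightarrow> real. 0 \<le> (\<Sum>x\<in>U. \<Sum>y\<in>U. c x * K (x, y) * c y))}"

definition kernel_tensor :: "'a topology \<Rightarrow> ('a \<times> 'a \<Rightarrow> real) \<Rightarrow> 'a tensor" where
  "kernel_tensor X K = (\<lambda>v \<in> tuples X 2. K (v 0, v 1))"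

text \<open>\<open>stk X d r\<close> maps tensors of order \<open>d\<close> to tensors of order \<open>d + r\<close>.\<close>

definition stk :: "'a topology \<Rightarrow> nat \<Rightarrow> nat \<Rightarrow> 'a tensor \<Rightarrow> 'a tensor" where
  "stk X d r T = (\<lambda>w \<in> tuples X (d + r). T (restrict w {..<d}))"

definition symmetrize :: "'a topology \<Rightarrow> nat \<Rightarrow> 'a tensor \<Rightarrow> 'a tensor" where
  "symmetrize X d T =
    (\<lambda>v \<in> tuples X d. (1 / fact d) * (\<Sum>\<pi> | \<pi> permutes {..<d}. T (v \<circ> \<pi>)))"

text \<open>
  \<^term>\<open>case_nat x (case_nat y z)\<close> is the tuple \<open>(x, y, z\<^sub>0, z\<^sub>1, \<dots>)\<close>; it is in
  \<^term>\<open>tuples X (r + 2)\<close> if \<open>x\<close>, \<open>y\<close> are points of \<open>X\<close> and \<^term>\<open>z \<in> tuples X r\<close>.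
\<close>

definition slice :: "'a topology \<Rightarrow> 'a tensor \<Rightarrow> (nat \<Rightarrow> 'a) \<Rightarrow> 'a \<times> 'a \<Rightarrow> real" where
  "slice X F z = (\<lambda>(x, y) \<in> topspace X \<times> topspace X. F (case_nat x (case_nat y z)))"

definition two_psd_tensors :: "'a topology \<Rightarrow> nat \<Rightarrow> 'a tensor set" where
  "two_psd_tensors X r =
    {F \<in> tensors X (r + 2).
      continuous_map (product_topology (\<lambda>_. X) {..<r + 2}) euclideanreal F \<and>
      (\<forall>z \<in> tuples X r. slice X F z \<in> psd_kernels X)}"

definition C_ker :: "'a topology \<Rightarrow> nat \<Rightarrow> ('a \<times> 'a \<Rightarrow> real) set" where
  "C_ker X r =
    {M \<in> kernels X. \<exists>N \<in> nonneg_tensors X (r + 2).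
      symmetrize X (r + 2) (stk X 2 r (kernel_tensor X M)) = symmetrize X (r + 2) N}"

definition Q_ker :: "'a topology \<Rightarrow> nat \<Rightarrow> ('a \<times> 'a \<Rightarrow> real) set" where
  "Q_ker X r =
    {M \<in> kernels X. \<exists>N \<in> nonneg_tensors X (r + 2). \<exists>S \<in> two_psd_tensors X r.
      symmetrize X (r + 2) (stk X 2 r (kernel_tensor X M)) =
        tensor_add X (r + 2) (symmetrize X (r + 2) N) (symmetrize X (r + 2) S)}"


section \<open>Symmetric matrices as kernels on a finite discrete space\<close>

definition mat_kernel :: "nat \<Rightarrow> real mat \<Rightarrow> nat \<times> nat \<Rightarrow> real" where
  "mat_kernel n M = (\<lambda>(i, j) \<in> {..<n} \<times> {..<n}. M $$ (i, j))"

lemma bij_betw_mat_kernel: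
  "bij_betw (mat_kernel n) (sym_mats n) (kernels (discrete_topology {..<n}))"
proof (rule bij_betw_byWitness[where f' = "mat n n"])
  show "\<forall>M \<in> sym_mats n. mat n n (mat_kernel n M) = M"
  proof
    fix M assume "M \<in> sym_mats n"
    then have "M \<in> carrier_mat n n"
      unfolding sym_mats_def by blast
    then show "mat n n (mat_kernel n M) = M"
      by (intro eq_matI) (simp_all add: mat_kernel_def)
  qed
  show "\<forall>K \<in> kernels (discrete_topology {..<n}). mat_kernel n (mat n n K) = K"
  proof
    fix K assume "K \<in> kernels (discrete_topology {..<n})"
    then have K: "K \<in> {..<n} \<times> {..<n} \<rightarrow>\<^sub>E UNIV"
      unfolding kernels_def mem_Collect_eq topspace_discrete_topology by blast
    show "mat_kernel n (mat n n K) = K"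
    proof
      fix p show "mat_kernel n (mat n n K) p = K p"
        using PiE_arb[OF K, of p] by (cases p) (auto simp: mat_kernel_def)
    qed
  qed
  show "mat_kernel n ` sym_mats n \<subseteq> kernels (discrete_topology {..<n})"
  proof (rule image_subsetI)
    fix M assume M: "M \<in> sym_mats n"
    have sym: "M $$ (i, j) = M $$ (j, i)" if "i < n" "j < n" for i j
    proof -
      have T: "transpose_mat M = M" and c: "M \<in> carrier_mat n n"
        using M unfolding sym_mats_def by blast+
      have "transpose_mat M $$ (i, j) = M $$ (j, i)"
        by (rule index_transpose_mat(1)) (use c that in auto)
      then show ?thesis unfolding T .
    qed
    have "mat_kernel n M (i, j) = mat_kernel n M (j, i)" if "i < n" "j < n" for i j
      using sym[OF that] that by (simp add: mat_kernel_def)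
    moreover have "mat_kernel n M \<in> {..<n} \<times> {..<n} \<rightarrow>\<^sub>E UNIV"
      unfolding mat_kernel_def by (rule restrict_PiE_iff[THEN iffD2]) simp
    moreover have "continuous_map (prod_topology (discrete_topology {..<n}) (discrete_topology {..<n}))
        euclideanreal (mat_kernel n M)"
      by (simp flip: prod_topology_discrete_topology)
    ultimately show "mat_kernel n M \<in> kernels (discrete_topology {..<n})"
      unfolding kernels_def mem_Collect_eq topspace_discrete_topology by blast
  qed
  show "mat n n ` kernels (discrete_topology {..<n}) \<subseteq> sym_mats n"
  proof (rule image_subsetI)
    fix K assume "K \<in> kernels (discrete_topology {..<n})"
    then have sym: "K (j, i) = K (i, j)" if "i < n" "j < n" for i j
      using that unfolding kernels_def mem_Collect_eq topspace_discrete_topology by blast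
    have "transpose_mat (mat n n K) = mat n n K"
      by (rule eq_matI) (simp_all add: sym)
    then show "mat n n K \<in> sym_mats n"
      unfolding sym_mats_def by simp
  qed
qed

end

theory Submission
  imports Defs "HOL-Combinatorics.Permutations"
begin

text \<open>
  A tensor \<open>T\<close> of order \<open>d\<close> determines the polynomial with a term \<open>T v * x_var (v 0) * \<dots> * x_var (v (d - 1))\<close>
  for each tuple \<open>v\<close>. The tuples giving a fixed monomial form one orbit under permutation, so
  symmetrization averages coefficients over these orbits: two tensors have equal symmetrizations
  iff their polynomials agree. The polynomial of the stacked tensor of \<open>M\<close> is
  \<open>(e\<^sup>T x)\<^sup>r (x\<^sup>T M x)\<close>, which gives the claim for \<open>C\<close>. For \<open>Q\<close>, the slices at all tuples \<open>z\<close>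
  with monomial \<open>x\<^sup>\<beta>\<close> are added up to a matrix for \<open>\<beta>\<close> (whose symmetric part is taken in the
  nonnegative case); conversely, the matrix for \<open>\<beta>\<close> is shared equally among these slices.
\<close>

section \<open>Tuples, their monomials and the polynomial of a tensor\<close>

definition tuple_exponent :: "nat \<Rightarrow> (nat \<Rightarrow> nat) \<Rightarrow> (nat \<Rightarrow>\<^sub>0 nat)" where
  "tuple_exponent d v = (\<Sum>k<d. Poly_Mapping.single (v k) 1)"

definition tensor_poly :: "nat topology \<Rightarrow> nat \<Rightarrow> nat tensor \<Rightarrow> rpoly" where
  "tensor_poly X d T = (\<Sum>v\<in>tuples X d. Poly_Mapping.single (tuple_exponent d v) (T v))"

text \<open>A nonempty fiber is one orbit of the permutations of positions; its size is the
  multinomial coefficient of \<alpha>.\<close>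

definition exponent_fiber :: "nat topology \<Rightarrow> nat \<Rightarrow> (nat \<Rightarrow>\<^sub>0 nat) \<Rightarrow> (nat \<Rightarrow> nat) set" where
  "exponent_fiber X d \<alpha> = {v \<in> tuples X d. tuple_exponent d v = \<alpha>}"

lemma finite_tuples: "finite (topspace X) \<Longrightarrow> finite (tuples X d)"
  unfolding tuples_def by (intro finite_PiE) auto

lemma finite_exponent_fiber: "finite (topspace X) \<Longrightarrow> finite (exponent_fiber X d \<alpha>)"
  unfolding exponent_fiber_def by (simp add: finite_tuples)

lemma card_exponent_fiber_pos:
  assumes "finite (topspace X)" "v \<in> tuples X d"
  shows "0 < card (exponent_fiber X d (tuple_exponent d v))"
  using assms finite_exponent_fiber[OF assms(1)]
  by (auto simp: card_gt_0_iff exponent_fiber_def)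

lemma lookup_tensor_poly:
  assumes "finite (topspace X)"
  shows "Poly_Mapping.lookup (tensor_poly X d T) \<alpha> = sum T (exponent_fiber X d \<alpha>)"
  unfolding tensor_poly_def exponent_fiber_def
  by (simp add: lookup_sum lookup_single when_def finite_tuples[OF assms] sum.inter_filter)

section \<open>Symmetrization and polynomials\<close>

lemma comp_permutes_tuples:
  assumes "\<pi> permutes {..<d}" "v \<in> tuples X d"
  shows "v \<circ> \<pi> \<in> tuples X d"
  using assms permutes_in_image[OF assms(1)] permutes_not_in[OF assms(1)]
  by (fastforce simp: tuples_def PiE_def Pi_def extensional_def)

lemma tuple_exponent_comp_permutes:
  assumes "\<pi> permutes {..<d}"
  shows "tuple_exponent d (v \<circ> \<pi>) = tuple_exponent d v"
  unfolding tuple_exponent_def comp_apply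
  by (rule sum.permute[OF assms, of "\<lambda>k. Poly_Mapping.single (v k) 1", symmetric, unfolded comp_def])

text \<open>Identifies the exponent with the multiset of entries, so that facts on rearranging
  multisets apply.\<close>

lemma count_tuple:
  "count (image_mset v (mset_set {..<d})) i = Poly_Mapping.lookup (tuple_exponent d v) i"
  unfolding tuple_exponent_def
  by (induction d) (auto simp: lessThan_Suc lookup_add lookup_single when_def)

text \<open>Equal exponents mean equal multisets of entries, and tuples with the same entries are
  rearrangements of each other.\<close>

lemma tuple_exponent_eq_imp_permutes:
  assumes "v \<in> tuples X d" "w \<in> tuples X d" "tuple_exponent d v = tuple_exponent d w"
  obtains \<pi> where "\<pi> permutes {..<d}" "v = w \<circ> \<pi>"
proof -
  have "image_mset v (mset_set {..<d}) = image_mset w (mset_set {..<d})"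
    by (rule multiset_eqI) (simp add: count_tuple assms)
  then obtain \<pi> where \<pi>: "\<pi> permutes {..<d}" and eq: "\<forall>k\<in>{..<d}. v k = w (\<pi> k)"
    by (rule image_mset_eq_implies_permutes[OF finite_lessThan])
  have "v = w \<circ> \<pi>"
  proof
    \<comment> \<open>For \<open>k \<ge> d\<close> both tuples are \<open>undefined\<close> and
      \<pi> fixes \<open>k\<close>.\<close>
    fix k show "v k = (w \<circ> \<pi>) k"
      using eq assms(1,2) permutes_not_in[OF \<pi>, of k]
      by (cases "k < d") (auto simp: tuples_def PiE_def extensional_def)
  qed
  with \<pi> show thesis by (rule that)
qed

text \<open>Composing with \<pi> on the right permutes the fiber, with composition by the inverse of
  \<pi> undoing it.\<close>

lemma sum_exponent_fiber_permute:
  assumes \<pi>: "\<pi> permutes {..<d}"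
  shows "(\<Sum>w\<in>exponent_fiber X d \<alpha>. f (w \<circ> \<pi>)) = sum f (exponent_fiber X d \<alpha>)"
proof (rule sum.reindex_bij_witness[where j = "\<lambda>w. w \<circ> \<pi>" and i = "\<lambda>w. w \<circ> inv_into UNIV \<pi>"])
  have inv: "inv_into UNIV \<pi> permutes {..<d}"
    by (rule permutes_inv[OF \<pi>])
  fix w assume w: "w \<in> exponent_fiber X d \<alpha>"
  show "w \<circ> \<pi> \<circ> inv_into UNIV \<pi> = w" "w \<circ> inv_into UNIV \<pi> \<circ> \<pi> = w"
    by (simp_all add: comp_assoc permutes_inv_o[OF \<pi>])
  show "w \<circ> \<pi> \<in> exponent_fiber X d \<alpha>" "w \<circ> inv_into UNIV \<pi> \<in> exponent_fiber X d \<alpha>"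
    using w comp_permutes_tuples tuple_exponent_comp_permutes \<pi> inv
    by (auto simp: exponent_fiber_def)
qed simp

lemma sum_permutes_comp:
  assumes \<rho>: "\<rho> permutes A"
  shows "(\<Sum>\<pi> | \<pi> permutes A. f (v \<circ> \<rho> \<circ> \<pi>)) = (\<Sum>\<pi> | \<pi> permutes A. f (v \<circ> \<pi>))"
  using setum_permutations_compose_left[OF \<rho>, of "\<lambda>\<pi>. f (v \<circ> \<pi>)"] by (simp add: comp_assoc)

text \<open>Double counting over pairs of a tuple \<open>w\<close> in the fiber and a permutation
  \<pi>. For fixed \<open>w\<close> the sum over \<pi> does not depend on \<open>w\<close>, because
  \<open>w\<close> is a rearrangement of \<open>v\<close>; for fixed \<pi> the sum over
  \<open>w\<close> is the coefficient. The \<open>d!\<close> permutations cancel the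
  normalization.\<close>

lemma card_fiber_times_symmetrize:
  assumes fin: "finite (topspace X)" and v: "v \<in> tuples X d"
  shows "real (card (exponent_fiber X d (tuple_exponent d v))) * symmetrize X d T v
    = Poly_Mapping.lookup (tensor_poly X d T) (tuple_exponent d v)"
proof -
  let ?F = "exponent_fiber X d (tuple_exponent d v)"
  let ?P = "{\<pi>. \<pi> permutes {..<d}}"
  have "(\<Sum>\<pi>\<in>?P. T (w \<circ> \<pi>)) = (\<Sum>\<pi>\<in>?P. T (v \<circ> \<pi>))" if "w \<in> ?F" for w
  proof -
    have "w \<in> tuples X d" "tuple_exponent d w = tuple_exponent d v"
      using that by (simp_all add: exponent_fiber_def)
    then obtain \<rho> where \<rho>: "\<rho> permutes {..<d}" "w = v \<circ> \<rho>"
      using v by (blast elim: tuple_exponent_eq_imp_permutes)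
    show ?thesis unfolding \<rho>(2) by (rule sum_permutes_comp[OF \<rho>(1)])
  qed
  then have "real (card ?F) * (\<Sum>\<pi>\<in>?P. T (v \<circ> \<pi>)) = (\<Sum>w\<in>?F. \<Sum>\<pi>\<in>?P. T (w \<circ> \<pi>))"
    by simp
  also have "\<dots> = (\<Sum>\<pi>\<in>?P. \<Sum>w\<in>?F. T (w \<circ> \<pi>))"
    by (rule sum.swap)
  also have "\<dots> = (\<Sum>\<pi>\<in>?P. sum T ?F)"
    by (rule sum.cong) (simp_all add: sum_exponent_fiber_permute)
  also have "\<dots> = fact d * sum T ?F"
    by (simp add: card_permutations[of "{..<d}" d])
  finally show ?thesis
    using v by (simp add: symmetrize_def lookup_tensor_poly[OF fin] field_simps)
qed

text \<open>Values of the symmetrization and coefficients differ by the positive fiber size, so each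
  determines the other. An exponent with empty fiber has coefficient 0.\<close>

lemma symmetrize_eq_iff:
  assumes fin: "finite (topspace X)"
  shows "symmetrize X d S = symmetrize X d T \<longleftrightarrow> tensor_poly X d S = tensor_poly X d T"
proof
  assume eq: "symmetrize X d S = symmetrize X d T"
  show "tensor_poly X d S = tensor_poly X d T"
  proof (rule poly_mapping_eqI)
    fix \<alpha>
    show "Poly_Mapping.lookup (tensor_poly X d S) \<alpha> = Poly_Mapping.lookup (tensor_poly X d T) \<alpha>"
    proof (cases "exponent_fiber X d \<alpha> = {}")
      case True
      then show ?thesis by (simp add: lookup_tensor_poly[OF fin])
    next
      case False
      then obtain v where "v \<in> tuples X d" "\<alpha> = tuple_exponent d v"
        by (auto simp: exponent_fiber_def)
      then show ?thesis
        by (simp add: eq flip: card_fiber_times_symmetrize[OF fin])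
    qed
  qed
next
  assume eq: "tensor_poly X d S = tensor_poly X d T"
  show "symmetrize X d S = symmetrize X d T"
  proof
    fix v show "symmetrize X d S v = symmetrize X d T v"
    proof (cases "v \<in> tuples X d")
      case True
      have "real (card (exponent_fiber X d (tuple_exponent d v))) * symmetrize X d S v
          = real (card (exponent_fiber X d (tuple_exponent d v))) * symmetrize X d T v"
        by (simp add: card_fiber_times_symmetrize[OF fin True] eq)
      then show ?thesis
        using card_exponent_fiber_pos[OF fin True] by simp
    next
      case False
      then show ?thesis by (simp add: symmetrize_def)
    qed
  qed
qed

text \<open>On each fiber the symmetrization is constantly the average of \<open>T\<close>, so the
  fiber sums are unchanged.\<close>

lemma tensor_poly_symmetrize:
  assumes fin: "finite (topspace X)"
  shows "tensor_poly X d (symmetrize X d T) = tensor_poly X d T"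
proof (rule poly_mapping_eqI)
  fix \<alpha>
  let ?F = "exponent_fiber X d \<alpha>"
  have "symmetrize X d T w = sum T ?F / real (card ?F)" if "w \<in> ?F" for w
    using that card_fiber_times_symmetrize[OF fin, of w d T] card_exponent_fiber_pos[OF fin, of w d]
    by (auto simp: exponent_fiber_def lookup_tensor_poly[OF fin] field_simps)
  then have "sum (symmetrize X d T) ?F = real (card ?F) * (sum T ?F / real (card ?F))"
    by simp
  then show "Poly_Mapping.lookup (tensor_poly X d (symmetrize X d T)) \<alpha>
      = Poly_Mapping.lookup (tensor_poly X d T) \<alpha>"
    using finite_exponent_fiber[OF fin, of d \<alpha>]
    by (cases "?F = {}") (simp_all add: lookup_tensor_poly[OF fin])
qed

lemma tensor_poly_add:
  "tensor_poly X d (tensor_add X d S T) = tensor_poly X d S + tensor_poly X d T"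
  unfolding tensor_poly_def by (simp add: tensor_add_def single_add sum.distrib)

text \<open>Merges the two symmetrizations in \<open>Q_ker\<close> into one, so that
  \<open>symmetrize_eq_iff\<close> applies to the whole identity.\<close>

lemma tensor_add_symmetrize:
  "tensor_add X d (symmetrize X d S) (symmetrize X d T) = symmetrize X d (tensor_add X d S T)"
proof
  fix v
  have "(\<Sum>\<pi> | \<pi> permutes {..<d}. tensor_add X d S T (v \<circ> \<pi>))
      = (\<Sum>\<pi> | \<pi> permutes {..<d}. S (v \<circ> \<pi>) + T (v \<circ> \<pi>))" if "v \<in> tuples X d"
    by (rule sum.cong) (simp_all add: tensor_add_def comp_permutes_tuples that)
  then have "symmetrize X d (tensor_add X d S T) v
      = (if v \<in> tuples X d then symmetrize X d S v + symmetrize X d T v else undefined)"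
    by (simp add: symmetrize_def sum.distrib add_divide_distrib)
  then show "tensor_add X d (symmetrize X d S) (symmetrize X d T) v
      = symmetrize X d (tensor_add X d S T) v"
    by (simp add: tensor_add_def)
qed

text \<open>Coefficients are fiber sums, hence nonnegative if \<open>N\<close> is. Conversely the
  symmetrization of \<open>T\<close> itself serves as \<open>N\<close>: its values are coefficients
  divided by fiber sizes.\<close>

lemma ex_nonneg_symmetrize_iff:
  assumes fin: "finite (topspace X)"
  shows "(\<exists>N\<in>nonneg_tensors X d. symmetrize X d T = symmetrize X d N)
    \<longleftrightarrow> (\<forall>\<alpha>. 0 \<le> Poly_Mapping.lookup (tensor_poly X d T) \<alpha>)"
proof
  assume "\<exists>N\<in>nonneg_tensors X d. symmetrize X d T = symmetrize X d N"
  then obtain N where N: "N \<in> nonneg_tensors X d" "tensor_poly X d T = tensor_poly X d N"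
    unfolding symmetrize_eq_iff[OF fin] by blast
  then show "\<forall>\<alpha>. 0 \<le> Poly_Mapping.lookup (tensor_poly X d T) \<alpha>"
    by (auto simp: lookup_tensor_poly[OF fin] nonneg_tensors_def exponent_fiber_def
        intro!: sum_nonneg)
next
  assume nonneg: "\<forall>\<alpha>. 0 \<le> Poly_Mapping.lookup (tensor_poly X d T) \<alpha>"
  have "0 \<le> symmetrize X d T v" if v: "v \<in> tuples X d" for v
    using card_fiber_times_symmetrize[OF fin v, of T] card_exponent_fiber_pos[OF fin v] nonneg
    by (metis of_nat_0_less_iff zero_le_mult_iff not_less)
  moreover have "symmetrize X d T \<in> tensors X d"
    by (simp add: tensors_def symmetrize_def)
  ultimately have "symmetrize X d T \<in> nonneg_tensors X d"
    by (simp add: nonneg_tensors_def)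
  moreover have "symmetrize X d T = symmetrize X d (symmetrize X d T)"
    unfolding symmetrize_eq_iff[OF fin] by (simp add: tensor_poly_symmetrize[OF fin])
  ultimately show "\<exists>N\<in>nonneg_tensors X d. symmetrize X d T = symmetrize X d N"
    by blast
qed

section \<open>Slicing tuples\<close>

lemma case_nat_in_tuples:
  assumes "i \<in> topspace X" "z \<in> tuples X d"
  shows "case_nat i z \<in> tuples X (Suc d)"
  using assms by (auto simp: tuples_def PiE_def extensional_def split: nat.split)

lemma bij_betw_case_nat_tuples:
  "bij_betw (\<lambda>(i, z). case_nat i z) (topspace X \<times> tuples X d) (tuples X (Suc d))"
proof (rule bij_betw_byWitness[where f' = "\<lambda>w. (w 0, w \<circ> Suc)"])
  show "\<forall>p\<in>topspace X \<times> tuples X d.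
      ((case p of (i, z) \<Rightarrow> case_nat i z) 0, (case p of (i, z) \<Rightarrow> case_nat i z) \<circ> Suc) = p"
    by (auto simp: fun_eq_iff)
  show "\<forall>w\<in>tuples X (Suc d). (case (w 0, w \<circ> Suc) of (i, z) \<Rightarrow> case_nat i z) = w"
    by (auto simp: fun_eq_iff split: nat.split)
  show "(\<lambda>(i, z). case_nat i z) ` (topspace X \<times> tuples X d) \<subseteq> tuples X (Suc d)"
    using case_nat_in_tuples by fast
  show "(\<lambda>w. (w 0, w \<circ> Suc)) ` tuples X (Suc d) \<subseteq> topspace X \<times> tuples X d"
    by (auto simp: tuples_def PiE_def extensional_def Pi_def)
qed

text \<open>Two applications split a tuple of order \<open>r + 2\<close> into the two matrix indices
  and the slice index \<open>z\<close>.\<close>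

lemma sum_tuples_Suc:
  "sum f (tuples X (Suc d)) = (\<Sum>i\<in>topspace X. \<Sum>z\<in>tuples X d. f (case_nat i z))"
  using sum.reindex_bij_betw[OF bij_betw_case_nat_tuples, of f X d]
  by (simp add: sum.cartesian_product case_prod_unfold)

lemma tuple_exponent_case_nat:
  "tuple_exponent (Suc d) (case_nat i z) = Poly_Mapping.single i 1 + tuple_exponent d z"
  unfolding tuple_exponent_def lessThan_Suc_eq_insert_0 by (simp add: sum.reindex)

lemma tuple_exponent_in_multi_indices:
  assumes "z \<in> tuples (discrete_topology {..<n}) r"
  shows "tuple_exponent r z \<in> multi_indices n r"
proof -
  have z: "z k < n" if "k < r" for k
    using assms that by (auto simp: tuples_def)
  have "Poly_Mapping.keys (tuple_exponent r z) \<subseteq> (\<Union>k<r. Poly_Mapping.keys (Poly_Mapping.single (z k) (1::nat)))"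
    unfolding tuple_exponent_def by (rule keys_sum)
  also have "\<dots> \<subseteq> {..<n}"
    using z by auto
  finally have "Poly_Mapping.keys (tuple_exponent r z) \<subseteq> {..<n}" .
  moreover have "(\<Sum>i<n. Poly_Mapping.lookup (tuple_exponent r z) i)
      = (\<Sum>k<r. \<Sum>i<n. if z k = i then 1 else 0)"
    unfolding tuple_exponent_def lookup_sum lookup_single when_def by (rule sum.swap)
  moreover have "\<dots> = (\<Sum>k<r. 1)"
    by (rule sum.cong) (simp_all add: z)
  ultimately show ?thesis
    by (simp add: multi_indices_def)
qed

text \<open>Ensures that a matrix for \<beta> has at least one slice to be placed in. The tuple is
  built by removing one variable from the monomial and prepending its index.\<close>

lemma exponent_fiber_nonempty:
  assumes "\<beta> \<in> multi_indices n r"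
  shows "exponent_fiber (discrete_topology {..<n}) r \<beta> \<noteq> {}"
  using assms
proof (induction r arbitrary: \<beta>)
  case 0
  then have "\<beta> = 0"
    by (intro poly_mapping_eqI) (auto simp: multi_indices_def in_keys_iff)
  then show ?case
    by (simp add: exponent_fiber_def tuples_def tuple_exponent_def)
next
  case (Suc r)
  from Suc.prems have "(\<Sum>i<n. Poly_Mapping.lookup \<beta> i) \<noteq> 0"
    by (simp add: multi_indices_def)
  then obtain i where i: "i < n" "Poly_Mapping.lookup \<beta> i \<noteq> 0"
    by (metis lessThan_iff sum.neutral)
  \<comment> \<open>The subtraction is truncated, but the exponent of \<open>i\<close> is nonzero,
    so adding the variable back recovers \<beta>.\<close>
  define \<gamma> where "\<gamma> = \<beta> - Poly_Mapping.single i 1"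
  have \<beta>: "\<beta> = Poly_Mapping.single i 1 + \<gamma>"
    using i(2) by (intro poly_mapping_eqI)
      (auto simp: \<gamma>_def lookup_add lookup_minus lookup_single when_def)
  have "Poly_Mapping.keys \<gamma> \<subseteq> Poly_Mapping.keys \<beta>"
    by (auto simp: \<beta> in_keys_iff lookup_add)
  moreover have "(\<Sum>j<n. Poly_Mapping.lookup \<beta> j) = 1 + (\<Sum>j<n. Poly_Mapping.lookup \<gamma> j)"
    using i(1) by (simp add: \<beta> lookup_add sum.distrib lookup_single when_def)
  ultimately have "\<gamma> \<in> multi_indices n r"
    using Suc.prems by (auto simp: multi_indices_def)
  then obtain z where "z \<in> tuples (discrete_topology {..<n}) r" "tuple_exponent r z = \<gamma>"
    using Suc.IH by (force simp: exponent_fiber_def)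
  then have "case_nat i z \<in> exponent_fiber (discrete_topology {..<n}) (Suc r) \<beta>"
    using i(1) by (simp add: exponent_fiber_def case_nat_in_tuples tuple_exponent_case_nat \<beta>)
  then show ?case by blast
qed

section \<open>Quadratic forms\<close>

lemma const_poly_add: "const_poly (a + b) = const_poly a + const_poly b"
  by (simp add: const_poly_def single_add)

lemma const_poly_sum: "const_poly (sum f A) = (\<Sum>z\<in>A. const_poly (f z))"
  by (induction A rule: infinite_finite_induct) (simp_all add: const_poly_add, simp_all add: const_poly_def)

lemma quad_form_mat:
  "quad_form n (mat n n f) = (\<Sum>i<n. \<Sum>j<n. const_poly (f (i, j)) * x_var i * x_var j)"
  unfolding quad_form_def by (intro sum.cong refl) simp

text \<open>Linearity in the matrix; it lets slices that share a monomial be added into one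
  matrix.\<close>

lemma quad_form_mat_sum:
  "quad_form n (mat n n (\<lambda>p. \<Sum>z\<in>A. f z p)) = (\<Sum>z\<in>A. quad_form n (mat n n (f z)))"
proof -
  have "quad_form n (mat n n (\<lambda>p. \<Sum>z\<in>A. f z p))
      = (\<Sum>i<n. \<Sum>z\<in>A. \<Sum>j<n. const_poly (f z (i, j)) * x_var i * x_var j)"
    unfolding quad_form_mat const_poly_sum sum_distrib_right
    by (intro sum.cong refl sum.swap)
  also have "\<dots> = (\<Sum>z\<in>A. quad_form n (mat n n (f z)))"
    unfolding quad_form_mat by (rule sum.swap)
  finally show ?thesis .
qed

text \<open>The monomial of \<open>x_var i * x_var j\<close> only sees
  \<open>f (i, j) + f (j, i)\<close>. This is needed since slices of a nonnegative tensor may be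
  asymmetric, while \<open>Q_mat\<close> asks for symmetric matrices.\<close>

lemma quad_form_mat_symmetric_part:
  "quad_form n (mat n n (\<lambda>(i, j). (f (i, j) + f (j, i)) / 2)) = quad_form n (mat n n f)"
proof -
  let ?t = "\<lambda>i j. const_poly (f (i, j) / 2) * x_var i * x_var j"
  have "quad_form n (mat n n (\<lambda>(i, j). (f (i, j) + f (j, i)) / 2))
      = (\<Sum>i<n. \<Sum>j<n. ?t i j) + (\<Sum>i<n. \<Sum>j<n. ?t j i)"
    by (simp add: quad_form_mat add_divide_distrib const_poly_add algebra_simps sum.distrib)
  also have "(\<Sum>i<n. \<Sum>j<n. ?t j i) = (\<Sum>i<n. \<Sum>j<n. ?t i j)"
    by (rule sum.swap)
  also have "(\<Sum>i<n. \<Sum>j<n. ?t i j) + (\<Sum>i<n. \<Sum>j<n. ?t i j)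
      = (\<Sum>i<n. \<Sum>j<n. (const_poly (f (i, j) / 2) + const_poly (f (i, j) / 2)) * x_var i * x_var j)"
    by (simp only: distrib_right sum.distrib)
  also have "\<dots> = quad_form n (mat n n f)"
    by (simp add: quad_form_mat flip: const_poly_add)
  finally show ?thesis .
qed

lemma tensor_poly_slices:
  fixes n r :: nat
  defines "X \<equiv> discrete_topology {..<n}"
  shows "tensor_poly X (r + 2) T
    = (\<Sum>z\<in>tuples X r. x_pow (tuple_exponent r z) * quad_form n (mat n n (slice X T z)))"
proof -
  let ?t = "\<lambda>i j z. Poly_Mapping.single (tuple_exponent (r + 2) (case_nat i (case_nat j z)))
      (T (case_nat i (case_nat j z)))"
  \<comment> \<open>The bounds on \<open>i\<close> and \<open>j\<close> keep \<open>slice\<close>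
    away from its default value.\<close>
  have t: "?t i j z
      = x_pow (tuple_exponent r z) * (const_poly (slice X T z (i, j)) * x_var i * x_var j)"
    if "i < n" "j < n" for i j z
    using that by (simp add: tuple_exponent_case_nat x_pow_def x_var_def const_poly_def mult_single
        slice_def X_def ac_simps)
  have "tensor_poly X (r + 2) T = (\<Sum>i<n. \<Sum>j<n. \<Sum>z\<in>tuples X r. ?t i j z)"
    by (simp add: tensor_poly_def sum_tuples_Suc X_def)
  also have "\<dots> = (\<Sum>i<n. \<Sum>z\<in>tuples X r. \<Sum>j<n. ?t i j z)"
    by (intro sum.cong refl sum.swap)
  also have "\<dots> = (\<Sum>z\<in>tuples X r. \<Sum>i<n. \<Sum>j<n. ?t i j z)"
    by (rule sum.swap)
  also have "\<dots> = (\<Sum>z\<in>tuples X r. \<Sum>i<n. \<Sum>j<n.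
      x_pow (tuple_exponent r z) * (const_poly (slice X T z (i, j)) * x_var i * x_var j))"
    by (intro sum.cong refl) (rule t; simp)
  finally show ?thesis
    by (simp add: quad_form_mat sum_distrib_left)
qed

text \<open>Groups the slices by their monomial, which gives the shape of the sums in
  \<open>Q_mat\<close>.\<close>

lemma tensor_poly_multi_indices:
  fixes n r :: nat
  defines "X \<equiv> discrete_topology {..<n}"
  shows "tensor_poly X (r + 2) T = (\<Sum>\<beta>\<in>multi_indices n r.
    x_pow \<beta> * quad_form n (mat n n (\<lambda>p. \<Sum>z\<in>exponent_fiber X r \<beta>. slice X T z p)))"
proof -
  let ?h = "\<lambda>z. x_pow (tuple_exponent r z) * quad_form n (mat n n (slice X T z))"
  have "tensor_poly X (r + 2) T = sum ?h (tuples X r)"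
    unfolding X_def by (rule tensor_poly_slices)
  also have "\<dots> = (\<Sum>\<beta>\<in>multi_indices n r. sum ?h {z \<in> tuples X r. tuple_exponent r z = \<beta>})"
    by (rule sum.group[symmetric])
      (auto simp: X_def finite_tuples finite_multi_indices tuple_exponent_in_multi_indices)
  also have "\<dots> = (\<Sum>\<beta>\<in>multi_indices n r. \<Sum>z\<in>exponent_fiber X r \<beta>.
      x_pow \<beta> * quad_form n (mat n n (slice X T z)))"
    by (intro sum.cong refl) (auto simp: exponent_fiber_def)
  finally show ?thesis
    by (simp add: quad_form_mat_sum sum_distrib_left)
qed

text \<open>The multinomial expansion before like terms are collected: one monomial for each choice
  of a variable from every factor.\<close>

lemma e_form_power:
  "e_form n ^ r = (\<Sum>z\<in>tuples (discrete_topology {..<n}) r. x_pow (tuple_exponent r z))"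
proof -
  have prod: "(\<Prod>k<r. x_var (z k)) = x_pow (tuple_exponent r z)" for z r
    unfolding tuple_exponent_def
    by (induction r) (simp_all add: x_var_def x_pow_def mult_single ac_simps)
  have "e_form n ^ r = (\<Prod>k<r. \<Sum>i<n. x_var i)"
    by (simp add: e_form_def)
  also have "\<dots> = (\<Sum>z\<in>{..<r} \<rightarrow>\<^sub>E {..<n}. \<Prod>k<r. x_var (z k))"
    by (rule prod_sum_PiE) simp_all
  finally show ?thesis
    by (simp add: prod tuples_def)
qed

lemma mat_mat_kernel: "M \<in> carrier_mat n n \<Longrightarrow> mat n n (mat_kernel n M) = M"
  by (intro eq_matI) (simp_all add: mat_kernel_def)

text \<open>Stacking ignores the last \<open>r\<close> arguments, so every slice is the kernel of
  \<open>M\<close> and the quadratic form factors out of the sum over \<open>z\<close>.\<close>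

lemma tensor_poly_stk_kernel:
  fixes n r :: nat
  defines "X \<equiv> discrete_topology {..<n}"
  assumes M: "M \<in> carrier_mat n n"
  shows "tensor_poly X (r + 2) (stk X 2 r (kernel_tensor X (mat_kernel n M)))
    = e_form n ^ r * quad_form n M"
proof -
  have "slice X (stk X 2 r (kernel_tensor X (mat_kernel n M))) z = mat_kernel n M"
    if z: "z \<in> tuples X r" for z
  proof
    fix p :: "nat \<times> nat"
    obtain i j where p: "p = (i, j)" by (cases p)
    show "slice X (stk X 2 r (kernel_tensor X (mat_kernel n M))) z p = mat_kernel n M p"
    proof (cases "i < n \<and> j < n")
      case True
      let ?w = "case_nat i (case_nat j z)"
      have "?w \<in> tuples X (2 + r)"
        using True z case_nat_in_tuples[of i X "case_nat j z" "Suc r"] case_nat_in_tuples[of j X z r]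
        by (simp add: X_def)
      moreover have "restrict ?w {..<2} \<in> tuples X 2"
        using True by (auto simp: tuples_def X_def less_2_cases_iff)
      ultimately have "stk X 2 r (kernel_tensor X (mat_kernel n M)) ?w = mat_kernel n M (i, j)"
        unfolding stk_def kernel_tensor_def by simp
      then show ?thesis
        using True by (simp add: p slice_def X_def)
    next
      case False
      then show ?thesis by (auto simp: p slice_def X_def mat_kernel_def)
    qed
  qed
  then show ?thesis
    unfolding X_def tensor_poly_slices e_form_power sum_distrib_right
    by (simp add: mat_mat_kernel[OF M])
qed

section \<open>Positive semidefinite kernels\<close>

text \<open>Coefficients become functions instead of vectors, as in
  \<open>psd_kernels\<close>.\<close>

lemma psd_mat_iff:
  assumes "M \<in> carrier_mat n n"
  shows "psd_mat n M \<longleftrightarrow> (\<forall>c. 0 \<le> (\<Sum>i<n. \<Sum>j<n. c i * M $$ (i, j) * c j))"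
proof -
  have form: "scalar_prod v (M *\<^sub>v v) = (\<Sum>i<n. \<Sum>j<n. vec_index v i * M $$ (i, j) * vec_index v j)"
    if "v \<in> carrier_vec n" for v
    using assms that
    by (auto simp: scalar_prod_def sum_distrib_left mult.assoc atLeast0LessThan intro!: sum.cong)
  show ?thesis
  proof
    assume psd: "psd_mat n M"
    show "\<forall>c. 0 \<le> (\<Sum>i<n. \<Sum>j<n. c i * M $$ (i, j) * c j)"
    proof
      fix c :: "nat \<Rightarrow> real"
      have "0 \<le> scalar_prod (vec n c) (M *\<^sub>v vec n c)"
        using psd by (simp add: psd_mat_def)
      then show "0 \<le> (\<Sum>i<n. \<Sum>j<n. c i * M $$ (i, j) * c j)"
        by (simp add: form)
    qed
  qed (simp add: psd_mat_def form)
qed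

text \<open>The kernel condition quantifies over all finite subsets, but the full index set implies
  the others.\<close>

lemma psd_kernels_discrete_iff:
  assumes K: "K \<in> kernels (discrete_topology {..<n})"
  shows "K \<in> psd_kernels (discrete_topology {..<n}) \<longleftrightarrow> psd_mat n (mat n n K)"
proof
  assume "K \<in> psd_kernels (discrete_topology {..<n})"
  then have "0 \<le> (\<Sum>i<n. \<Sum>j<n. c i * K (i, j) * c j)" for c
    by (simp add: psd_kernels_def)
  then show "psd_mat n (mat n n K)"
    by (subst psd_mat_iff) simp_all
next
  assume "psd_mat n (mat n n K)"
  then have psd: "0 \<le> (\<Sum>i<n. \<Sum>j<n. c i * K (i, j) * c j)" for c
    by (subst (asm) psd_mat_iff) simp_all
  have "0 \<le> (\<Sum>x\<in>U. \<Sum>y\<in>U. c x * K (x, y) * c y)" if U: "U \<subseteq> {..<n}" for U and c :: "nat \<Rightarrow> real"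
  proof -
    \<comment> \<open>Extending the coefficients by zero turns the form on \<open>U\<close> into the
      form on all indices.\<close>
    let ?c = "\<lambda>i. if i \<in> U then c i else 0"
    have inner: "(\<Sum>y<n. ?c x * K (x, y) * ?c y) = (\<Sum>y\<in>U. ?c x * K (x, y) * ?c y)" for x
      by (rule sum.mono_neutral_right) (use U in auto)
    have "(\<Sum>x<n. \<Sum>y<n. ?c x * K (x, y) * ?c y) = (\<Sum>x\<in>U. \<Sum>y\<in>U. ?c x * K (x, y) * ?c y)"
      unfolding inner by (rule sum.mono_neutral_right) (use U in auto)
    then show ?thesis
      using psd[of ?c] by simp
  qed
  then show "K \<in> psd_kernels (discrete_topology {..<n})"
    using K by (simp add: psd_kernels_def)
qed

lemma psd_mat_sum:
  assumes "\<And>z. z \<in> A \<Longrightarrow> psd_mat n (mat n n (f z))"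
  shows "psd_mat n (mat n n (\<lambda>p. \<Sum>z\<in>A. f z p))"
proof -
  have "(\<Sum>i<n. \<Sum>j<n. c i * (\<Sum>z\<in>A. f z (i, j)) * c j)
      = (\<Sum>z\<in>A. \<Sum>i<n. \<Sum>j<n. c i * f z (i, j) * c j)" for c :: "nat \<Rightarrow> real"
  proof -
    have "(\<Sum>i<n. \<Sum>j<n. c i * (\<Sum>z\<in>A. f z (i, j)) * c j)
        = (\<Sum>i<n. \<Sum>z\<in>A. \<Sum>j<n. c i * f z (i, j) * c j)"
      unfolding sum_distrib_left sum_distrib_right by (intro sum.cong refl sum.swap)
    also have "\<dots> = (\<Sum>z\<in>A. \<Sum>i<n. \<Sum>j<n. c i * f z (i, j) * c j)"
      by (rule sum.swap)
    finally show ?thesis .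
  qed
  moreover have "0 \<le> (\<Sum>i<n. \<Sum>j<n. c i * f z (i, j) * c j)" if "z \<in> A" for c z
    using assms[OF that] by (subst (asm) psd_mat_iff) simp_all
  ultimately show ?thesis
    by (subst psd_mat_iff) (simp_all add: sum_nonneg)
qed

lemma mat_in_sym_mats_iff:
  "mat n n f \<in> sym_mats n \<longleftrightarrow> (\<forall>i<n. \<forall>j<n. f (i, j) = f (j, i))"
  unfolding sym_mats_def by (auto simp: mat_eq_iff)

text \<open>Every function on the product is continuous, since a product of two discrete spaces is
  discrete.\<close>

lemma kernels_discrete_iff:
  "K \<in> kernels (discrete_topology {..<n})
    \<longleftrightarrow> K \<in> extensional ({..<n} \<times> {..<n}) \<and> (\<forall>i<n. \<forall>j<n. K (i, j) = K (j, i))"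
  by (auto simp: kernels_def PiE_def simp flip: prod_topology_discrete_topology)

text \<open>A point is a box of open singletons, and such a box is open because \<open>I\<close> is
  finite. This discharges the continuity condition in \<open>two_psd_tensors\<close>.\<close>

lemma product_topology_discrete_topology:
  assumes "finite I"
  shows "product_topology (\<lambda>i. discrete_topology (A i)) I = discrete_topology (Pi\<^sub>E I A)"
proof -
  have "openin (product_topology (\<lambda>i. discrete_topology (A i)) I) {x}" if x: "x \<in> Pi\<^sub>E I A" for x
  proof -
    have "{x} = Pi\<^sub>E I (\<lambda>i. {x i})"
      using PiE_singleton[of x I] x by (simp add: PiE_def)
    moreover have "openin (product_topology (\<lambda>i. discrete_topology (A i)) I) (Pi\<^sub>E I (\<lambda>i. {x i}))"
      using assms x by (subst openin_PiE) auto
    ultimately show ?thesis by simp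
  qed
  then show ?thesis
    by (intro sym[OF iffD2[OF discrete_topology_unique]]) simp
qed

section \<open>Spreading matrices over tensors\<close>

text \<open>\<open>w \<circ> Suc \<circ> Suc\<close> is the slice index \<open>z\<close> of
  \<open>w\<close>; the divisor is the number of slices that share the matrix of \<beta>.\<close>

definition spread_tensor :: "nat \<Rightarrow> nat \<Rightarrow> ((nat \<Rightarrow>\<^sub>0 nat) \<Rightarrow> real mat) \<Rightarrow> nat tensor" where
  "spread_tensor n r B = (\<lambda>w \<in> tuples (discrete_topology {..<n}) (r + 2).
    let \<beta> = tuple_exponent r (w \<circ> Suc \<circ> Suc) in
    B \<beta> $$ (w 0, w 1) / real (card (exponent_fiber (discrete_topology {..<n}) r \<beta>)))"

lemma slice_spread_tensor:
  fixes n r :: nat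
  defines "X \<equiv> discrete_topology {..<n}"
  assumes z: "z \<in> tuples X r" and ij: "i < n" "j < n"
  shows "slice X (spread_tensor n r B) z (i, j)
    = B (tuple_exponent r z) $$ (i, j) / real (card (exponent_fiber X r (tuple_exponent r z)))"
proof -
  have "case_nat i (case_nat j z) \<in> tuples X (r + 2)"
    using ij z case_nat_in_tuples[of i X "case_nat j z" "Suc r"] case_nat_in_tuples[of j X z r]
    by (simp add: X_def)
  moreover have "case_nat i (case_nat j z) \<circ> Suc \<circ> Suc = z"
    by (simp add: fun_eq_iff)
  ultimately show ?thesis
    using ij by (simp add: slice_def spread_tensor_def X_def Let_def)
qed

text \<open>The equal shares over the fiber of \<beta> add up to \<open>B \<beta>\<close>
  again.\<close>

lemma tensor_poly_spread_tensor:
  "tensor_poly (discrete_topology {..<n}) (r + 2) (spread_tensor n r B)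
    = (\<Sum>\<beta>\<in>multi_indices n r. x_pow \<beta> * quad_form n (B \<beta>))"
  unfolding tensor_poly_multi_indices
proof (intro sum.cong refl arg_cong[where f = "(*) _"])
  fix \<beta> assume "\<beta> \<in> multi_indices n r"
  let ?X = "discrete_topology {..<n}"
  let ?F = "exponent_fiber ?X r \<beta>"
  \<comment> \<open>Without this, division by zero would lose \<open>B \<beta>\<close>.\<close>
  have "card ?F \<noteq> 0"
    using exponent_fiber_nonempty[OF \<open>\<beta> \<in> _\<close>] by (simp add: finite_exponent_fiber)
  moreover have "(\<Sum>z\<in>?F. slice ?X (spread_tensor n r B) z (i, j))
      = (\<Sum>z\<in>?F. B \<beta> $$ (i, j) / real (card ?F))" if "i < n" "j < n" for i j
    by (rule sum.cong) (use that in \<open>auto simp: exponent_fiber_def slice_spread_tensor\<close>)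
  ultimately have "(\<Sum>z\<in>?F. slice ?X (spread_tensor n r B) z (i, j)) = B \<beta> $$ (i, j)"
    if "i < n" "j < n" for i j
    using that by simp
  then show "quad_form n (mat n n (\<lambda>p. \<Sum>z\<in>?F. slice ?X (spread_tensor n r B) z p))
      = quad_form n (B \<beta>)"
    unfolding quad_form_mat by (simp add: quad_form_def)
qed

lemma spread_tensor_in_nonneg_tensors:
  assumes "\<And>\<beta>. \<beta> \<in> multi_indices n r \<Longrightarrow> nonneg_mat n (B \<beta>)"
  shows "spread_tensor n r B \<in> nonneg_tensors (discrete_topology {..<n}) (r + 2)"
proof -
  have "w \<circ> Suc \<circ> Suc \<in> tuples (discrete_topology {..<n}) r \<and> w 0 < n \<and> w 1 < n"
    if "w \<in> tuples (discrete_topology {..<n}) (r + 2)" for w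
    using that by (auto simp: tuples_def PiE_def extensional_def Pi_def)
  then show ?thesis
    using assms tuple_exponent_in_multi_indices
    by (auto simp: nonneg_tensors_def tensors_def spread_tensor_def nonneg_mat_def Let_def)
qed

text \<open>Each slice is a nonnegative multiple of some \<open>B \<beta>\<close>, so symmetry and
  semidefiniteness carry over.\<close>

lemma spread_tensor_in_two_psd_tensors:
  assumes B: "\<And>\<beta>. \<beta> \<in> multi_indices n r \<Longrightarrow> B \<beta> \<in> sym_mats n \<and> psd_mat n (B \<beta>)"
  shows "spread_tensor n r B \<in> two_psd_tensors (discrete_topology {..<n}) r"
proof -
  let ?X = "discrete_topology {..<n}"
  have "slice ?X (spread_tensor n r B) z \<in> psd_kernels ?X" if z: "z \<in> tuples ?X r" for z
  proof -
    let ?\<beta> = "tuple_exponent r z" and ?S = "slice ?X (spread_tensor n r B) z"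
    let ?m = "real (card (exponent_fiber ?X r ?\<beta>))"
    have \<beta>: "B ?\<beta> \<in> sym_mats n" "psd_mat n (B ?\<beta>)"
      using B[OF tuple_exponent_in_multi_indices[OF z]] by blast+
    have "B ?\<beta> $$ (i, j) = B ?\<beta> $$ (j, i)" if "i < n" "j < n" for i j
      using \<beta>(1) that by (metis (mono_tags, lifting) carrier_matD index_transpose_mat(1) mem_Collect_eq sym_mats_def)
    then have "?S \<in> kernels ?X"
      using z by (auto simp: kernels_discrete_iff slice_spread_tensor) (simp add: slice_def)
    moreover have "psd_mat n (mat n n ?S)"
    proof -
      have "(\<Sum>i<n. \<Sum>j<n. c i * ?S (i, j) * c j)
          = (\<Sum>i<n. \<Sum>j<n. c i * B ?\<beta> $$ (i, j) * c j) / ?m" for c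
        using z by (simp add: slice_spread_tensor sum_divide_distrib)
      moreover have "0 \<le> (\<Sum>i<n. \<Sum>j<n. c i * B ?\<beta> $$ (i, j) * c j)" for c
        using \<beta> psd_mat_iff[of "B ?\<beta>" n] by (simp add: sym_mats_def)
      ultimately show ?thesis
        by (subst psd_mat_iff) simp_all
    qed
    ultimately show ?thesis
      by (simp add: psd_kernels_discrete_iff)
  qed
  then show ?thesis
    by (simp add: two_psd_tensors_def tensors_def product_topology_discrete_topology)
      (simp add: spread_tensor_def tuples_def)
qed

section \<open>Comparison of the matrix cones with the kernel cones\<close>

lemma mat_kernel_in_C_ker_iff:
  assumes M: "M \<in> sym_mats n"
  shows "mat_kernel n M \<in> C_ker (discrete_topology {..<n}) r \<longleftrightarrow> M \<in> C_mat n r"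
proof -
  have "M \<in> carrier_mat n n" "mat_kernel n M \<in> kernels (discrete_topology {..<n})"
    using M bij_betwE[OF bij_betw_mat_kernel] by (auto simp: sym_mats_def)
  then show ?thesis
    using M unfolding C_ker_def C_mat_def
    \<comment> \<open>The order must stay in the form \<open>r + 2\<close> for
      \<open>tensor_poly_stk_kernel\<close> to match.\<close>
    by (simp add: ex_nonneg_symmetrize_iff tensor_poly_stk_kernel del: add_2_eq_Suc')
qed

text \<open>Stated for an arbitrary polynomial \<open>p\<close>, so that it rewrites the existential
  condition of \<open>Q_mat\<close> as one on tensors.\<close>

lemma ex_multi_index_matrices_iff:
  fixes n r :: nat
  defines "X \<equiv> discrete_topology {..<n}"
  shows "(\<exists>N S. (\<forall>\<beta> \<in> multi_indices n r.
        N \<beta> \<in> sym_mats n \<and> S \<beta> \<in> sym_mats n \<and> nonneg_mat n (N \<beta>) \<and> psd_mat n (S \<beta>)) \<and>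
      p = (\<Sum>\<beta> \<in> multi_indices n r. x_pow \<beta> * quad_form n (N \<beta>)) +
        (\<Sum>\<beta> \<in> multi_indices n r. x_pow \<beta> * quad_form n (S \<beta>)))
    \<longleftrightarrow> (\<exists>N \<in> nonneg_tensors X (r + 2). \<exists>S \<in> two_psd_tensors X r.
      p = tensor_poly X (r + 2) N + tensor_poly X (r + 2) S)"
    (is "?L \<longleftrightarrow> ?R")
proof
  assume ?L
  then obtain N S where NS: "\<And>\<beta>. \<beta> \<in> multi_indices n r \<Longrightarrow>
        N \<beta> \<in> sym_mats n \<and> S \<beta> \<in> sym_mats n \<and> nonneg_mat n (N \<beta>) \<and> psd_mat n (S \<beta>)"
    and p: "p = tensor_poly X (r + 2) (spread_tensor n r N) + tensor_poly X (r + 2) (spread_tensor n r S)"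
    unfolding X_def tensor_poly_spread_tensor by blast
  have "spread_tensor n r N \<in> nonneg_tensors X (r + 2)"
    unfolding X_def by (rule spread_tensor_in_nonneg_tensors) (use NS in blast)
  moreover have "spread_tensor n r S \<in> two_psd_tensors X r"
    unfolding X_def by (rule spread_tensor_in_two_psd_tensors) (use NS in blast)
  ultimately show ?R
    using p by blast
next
  assume ?R
  then obtain N S where N: "N \<in> nonneg_tensors X (r + 2)" and S: "S \<in> two_psd_tensors X r"
    and p: "p = tensor_poly X (r + 2) N + tensor_poly X (r + 2) S"
    by blast
  define f where "f T \<beta> q = (\<Sum>z\<in>exponent_fiber X r \<beta>. slice X T z q)" for T \<beta> q
  \<comment> \<open>Only the nonnegative part is symmetrized; the slices of \<open>S\<close> are
    kernels and hence already symmetric.\<close>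
  define N' where "N' \<beta> = mat n n (\<lambda>(i, j). (f N \<beta> (i, j) + f N \<beta> (j, i)) / 2)" for \<beta>
  define S' where "S' \<beta> = mat n n (f S \<beta>)" for \<beta>
  have "0 \<le> slice X N z (i, j)" if "z \<in> tuples X r" "i < n" "j < n" for i j z
    using that N case_nat_in_tuples[of i X "case_nat j z" "Suc r"] case_nat_in_tuples[of j X z r]
    by (simp add: nonneg_tensors_def slice_def X_def)
  then have "0 \<le> f N \<beta> (i, j)" if "i < n" "j < n" for \<beta> i j
    using that by (auto simp: f_def exponent_fiber_def intro!: sum_nonneg)
  then have N': "N' \<beta> \<in> sym_mats n" "nonneg_mat n (N' \<beta>)" for \<beta>
    by (simp_all add: N'_def mat_in_sym_mats_iff nonneg_mat_def)
  have psd: "slice X S z \<in> psd_kernels X" if "z \<in> tuples X r" for z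
    using S that by (simp add: two_psd_tensors_def)
  then have ker: "slice X S z \<in> kernels X" if "z \<in> tuples X r" for z
    using that by (simp add: psd_kernels_def)
  have "slice X S z (i, j) = slice X S z (j, i)" if "z \<in> tuples X r" "i < n" "j < n" for i j z
    using ker[OF that(1)] that unfolding X_def kernels_discrete_iff by blast
  then have "f S \<beta> (i, j) = f S \<beta> (j, i)" if "i < n" "j < n" for \<beta> i j
    using that unfolding f_def by (intro sum.cong refl) (simp add: exponent_fiber_def)
  then have S'_sym: "S' \<beta> \<in> sym_mats n" for \<beta>
    by (simp add: S'_def mat_in_sym_mats_iff)
  have S'_psd: "psd_mat n (S' \<beta>)" for \<beta>
    unfolding S'_def f_def
    by (rule psd_mat_sum)
      (use psd ker psd_kernels_discrete_iff in \<open>auto simp: X_def exponent_fiber_def\<close>)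
  have "tensor_poly X (r + 2) N = (\<Sum>\<beta>\<in>multi_indices n r. x_pow \<beta> * quad_form n (N' \<beta>))"
    unfolding N'_def quad_form_mat_symmetric_part
    unfolding f_def X_def tensor_poly_multi_indices ..
  moreover have "tensor_poly X (r + 2) S = (\<Sum>\<beta>\<in>multi_indices n r. x_pow \<beta> * quad_form n (S' \<beta>))"
    unfolding S'_def f_def X_def tensor_poly_multi_indices ..
  ultimately have "p = (\<Sum>\<beta> \<in> multi_indices n r. x_pow \<beta> * quad_form n (N' \<beta>)) +
      (\<Sum>\<beta> \<in> multi_indices n r. x_pow \<beta> * quad_form n (S' \<beta>))"
    by (simp only: p)
  then show ?L
    by (intro exI[of _ N'] exI[of _ S']) (simp add: N' S'_sym S'_psd)
qed

text \<open>Both memberships reduce to the same statement: the polynomial of \<open>M\<close> is a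
  sum of the polynomials of a nonnegative and a 2-PSD tensor.\<close>

lemma mat_kernel_in_Q_ker_iff:
  assumes M: "M \<in> sym_mats n"
  shows "mat_kernel n M \<in> Q_ker (discrete_topology {..<n}) r \<longleftrightarrow> M \<in> Q_mat n r"
proof -
  have c: "M \<in> carrier_mat n n" and k: "mat_kernel n M \<in> kernels (discrete_topology {..<n})"
    using M bij_betwE[OF bij_betw_mat_kernel] by (auto simp: sym_mats_def)
  have fin: "finite (topspace (discrete_topology {..<n}))"
    by simp
  show ?thesis
    unfolding Q_ker_def Q_mat_def mem_Collect_eq ex_multi_index_matrices_iff
      tensor_add_symmetrize symmetrize_eq_iff[OF fin] tensor_poly_stk_kernel[OF c] tensor_poly_add
    using M k by blast
qed

theorem proposition1:
  fixes n r :: nat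
  assumes "n \<ge> 1"
  shows "mat_kernel n ` C_mat n r = C_ker (discrete_topology {..<n}) r
       \<and> mat_kernel n ` Q_mat n r = Q_ker (discrete_topology {..<n}) r"
proof -
  let ?X = "discrete_topology {..<n}"
  have img: "mat_kernel n ` sym_mats n = kernels ?X"
    using bij_betw_mat_kernel by (rule bij_betw_imp_surj_on)
  \<comment> \<open>Every kernel in the cones comes from a symmetric matrix, so the membership
    equivalences give equality of the images.\<close>
  have "C_mat n r \<subseteq> sym_mats n" "Q_mat n r \<subseteq> sym_mats n"
    "C_ker ?X r \<subseteq> mat_kernel n ` sym_mats n" "Q_ker ?X r \<subseteq> mat_kernel n ` sym_mats n"
    unfolding img by (auto simp: C_mat_def Q_mat_def C_ker_def Q_ker_def)
  then show ?thesis
    using mat_kernel_in_C_ker_iff mat_kernel_in_Q_ker_iff by blast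
qed

end
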